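(* Assume that $$0<w(t)-r(t)\le\min_{i\in\mathcal N}\left\{\frac{\nu_i^{\max}}{g_i}\right\}g_{\mathcal N}\quad\text{for all }1\le t\le T,\qquad\text{and}\qquad \sum_{t=1}^Tw(t)=g_{\mathcal N}+\sum_{t=1}^Tr(t).$$ Let $\boldsymbol\pi_0^*$ be the leader's strategy whose $t$-th component is $1+\frac1n+\frac{\nu_{\mathcal N}(t)}{w(t)-r(t)}$, $t=1,\dots,T$, and let $\boldsymbol\chi^*=(\boldsymbol\chi_1^*,\dots,\boldsymbol\chi_n^* )^\top$ with $$\boldsymbol\chi_i^*:=\frac{g_i}{g_{\mathcal N}}\big(w(1)-r(1),\dots,w(T)-r(T)\big)^\top,\qquad i\in\mathcal N.$$ Then $(\boldsymbol\pi_0^*,\boldsymbol\chi^* )$ is a perfect Stackelberg equilibrium of the Stackelberg game, in which all electricity is provided by uncontrollable energy sources, without energy storage or waste; that is, under $\boldsymbol\chi^*$ the controllable supply satisfies $c(t)=\nu_{\mathcal N}(t)+r(t)-w(t)=0$ for all $1\le t\le T$.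
   Context: Let $n,T$ be positive integers and $\mathcal N=\{1,\dots,n\}$ (followers, i.e. flexible electricity users). For each $i\in\mathcal N$ let $g_i>0$ (total demand) and $\nu_i^{\max}\ge g_i/T$ (maximal demand per time slot). Let $r(t),w(t)$, $t=1,\dots,T$, be given real sequences (demand of regular users, uncontrollable power generation). Put $g_{\mathcal N}=\sum_{i\in\mathcal N}g_i$. A strategy of follower $i$ is $\boldsymbol\nu_i=(\nu_i(1),\dots,\nu_i(T))^\top\in\mathbb R^T$; it is feasible if $\sum_{t=1}^T\nu_i(t)=g_i$ and $0\le\nu_i(t)\le\nu_i^{\max}$ for all $t$. Write $\boldsymbol\nu=(\boldsymbol\nu_1,\dots,\boldsymbol\nu_n)^\top$, $\boldsymbol\nu_{-i}$ for the strategies of all followers except $i$, and $\nu_{\mathcal N}(t)=\sum_{i\in\mathcal N}\nu_i(t)$. A leader's strategy is $\boldsymbol\pi=(\pi(1),\dots,\pi(T))^\top$, where $\pi(t)=\pi(\nu_{\mathcal N}(t),r(t),w(t))$ is a price that is a function of $\nu_{\mathcal N}(t),r(t),w(t)$. Follower game: given $\boldsymbol\pi$, each follower $i$ minimizes the cost $$u_i^f(\boldsymbol\pi,\boldsymbol\nu_i,\boldsymbol\nu_{-i})=\sum_{t=1}^T\pi(\nu_{\mathcal N}(t),r(t),w(t))\,\nu_i(t)$$ over its feasible strategies. A feasible combination $\boldsymbol\nu$ is a Nash equilibrium if $u_i^f(\boldsymbol\pi,\boldsymbol\nu_i',\boldsymbol\nu_{-i})\ge u_i^f(\boldsymbol\pi,\boldsymbol\nu_i,\boldsymbol\nu_{-i})$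 for every $i$ and every feasible $\boldsymbol\nu_i'$. Leader's cost: $c(t)=\nu_{\mathcal N}(t)+r(t)-w(t)$ is the controllable energy supply needed at time $t$; with $\bar c=\frac1T\sum_{t=1}^Tc(t)$, $$u^l(\boldsymbol\pi,\boldsymbol\nu)=\frac1T\sum_{t=1}^T[c(t)-\bar c]^2 .$$ Stackelberg equilibrium: $(\hat{\boldsymbol\pi},\hat{\boldsymbol\nu})$ is a Stackelberg equilibrium if $\hat{\boldsymbol\nu}$ is a Nash equilibrium of the follower game under $\hat{\boldsymbol\pi}$ and $u^l(\hat{\boldsymbol\pi},\hat{\boldsymbol\nu})\le u^l(\boldsymbol\pi,\boldsymbol\nu)$ for every leader's strategy $\boldsymbol\pi$ and every Nash equilibrium $\boldsymbol\nu$ of the follower game under $\boldsymbol\pi$. It is perfect if moreover $u^l(\hat{\boldsymbol\pi},\hat{\boldsymbol\nu})=0$. *)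

theory Defs
  imports "HOL-Analysis.Analysis"
begin

text \<open>
  Followers are indexed by a finite type \<open>'n\<close> (so \<open>n = CARD('n)\<close>) and time slots by a finite
  type \<open>'t\<close> (so \<open>T = CARD('t)\<close>). A combination of strategies is a family of vectors
  \<open>\<nu> :: 'n \<Rightarrow> real ^ 't\<close>; the unilateral deviation \<open>(\<nu>\<^sub>i', \<nu>\<^sub>-\<^sub>i)\<close> is the update \<open>\<nu>(i := \<nu>\<^sub>i')\<close>.
\<close>

definition total_demand :: "('n::finite \<Rightarrow> real) \<Rightarrow> real" where
  "total_demand g = (\<Sum>i\<in>UNIV. g i)"

definition aggregate :: "('n::finite \<Rightarrow> real ^ 't) \<Rightarrow> 't \<Rightarrow> real" where
  "aggregate \<nu> t = (\<Sum>i\<in>UNIV. \<nu> i $ t)"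

definition feasible :: "real \<Rightarrow> real \<Rightarrow> real ^ 't::finite \<Rightarrow> bool" where
  "feasible gi numax_i x \<longleftrightarrow>
     (\<Sum>t\<in>UNIV. x $ t) = gi \<and> (\<forall>t. 0 \<le> x $ t \<and> x $ t \<le> numax_i)"

text \<open>
  A leader's strategy is one pricing rule, of the three arguments \<open>\<nu>\<^sub>N(t)\<close>, \<open>r(t)\<close>, \<open>w(t)\<close>; its
  component at time \<open>t\<close> is the value of the rule at these arguments. No sign, monotonicity or
  continuity of the rule is required.
\<close>

type_synonym leader_strategy = "real \<Rightarrow> real \<Rightarrow> real \<Rightarrow> real"

definition follower_cost ::
  "('t::finite \<Rightarrow> real) \<Rightarrow> ('t \<Rightarrow> real) \<Rightarrow> 'n::finite \<Rightarrow> leader_strategy \<Rightarrow> ('n \<Rightarrow> real ^ 't) \<Rightarrow> real"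
where
  "follower_cost r w i \<pi> \<nu> = (\<Sum>t\<in>UNIV. \<pi> (aggregate \<nu> t) (r t) (w t) * \<nu> i $ t)"

definition nash_equilibrium ::
  "('n::finite \<Rightarrow> real) \<Rightarrow> ('n \<Rightarrow> real) \<Rightarrow> ('t::finite \<Rightarrow> real) \<Rightarrow> ('t \<Rightarrow> real) \<Rightarrow>
   leader_strategy \<Rightarrow> ('n \<Rightarrow> real ^ 't) \<Rightarrow> bool"
where
  "nash_equilibrium g numax r w \<pi> \<nu> \<longleftrightarrow>
     (\<forall>i. feasible (g i) (numax i) (\<nu> i)) \<and>
     (\<forall>i x. feasible (g i) (numax i) x \<longrightarrow>
        follower_cost r w i \<pi> (\<nu>(i := x)) \<ge> follower_cost r w i \<pi> \<nu>)"

definition controllable_supply ::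
  "('t \<Rightarrow> real) \<Rightarrow> ('t \<Rightarrow> real) \<Rightarrow> ('n::finite \<Rightarrow> real ^ 't) \<Rightarrow> 't \<Rightarrow> real"
where
  "controllable_supply r w \<nu> t = aggregate \<nu> t + r t - w t"

definition mean_supply ::
  "('t::finite \<Rightarrow> real) \<Rightarrow> ('t \<Rightarrow> real) \<Rightarrow> ('n::finite \<Rightarrow> real ^ 't) \<Rightarrow> real"
where
  "mean_supply r w \<nu> = (1 / real CARD('t)) * (\<Sum>t\<in>UNIV. controllable_supply r w \<nu> t)"

text \<open>The price enters the leader's cost only through the followers' response to it.\<close>

definition leader_cost ::
  "('t::finite \<Rightarrow> real) \<Rightarrow> ('t \<Rightarrow> real) \<Rightarrow> leader_strategy \<Rightarrow> ('n::finite \<Rightarrow> real ^ 't) \<Rightarrow> real"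
where
  "leader_cost r w \<pi> \<nu> =
     (1 / real CARD('t)) * (\<Sum>t\<in>UNIV. (controllable_supply r w \<nu> t - mean_supply r w \<nu>)\<^sup>2)"

definition stackelberg_equilibrium ::
  "('n::finite \<Rightarrow> real) \<Rightarrow> ('n \<Rightarrow> real) \<Rightarrow> ('t::finite \<Rightarrow> real) \<Rightarrow> ('t \<Rightarrow> real) \<Rightarrow>
   leader_strategy \<Rightarrow> ('n \<Rightarrow> real ^ 't) \<Rightarrow> bool"
where
  "stackelberg_equilibrium g numax r w \<pi> \<nu> \<longleftrightarrow>
     nash_equilibrium g numax r w \<pi> \<nu> \<and>
     (\<forall>\<pi>' \<nu>'. nash_equilibrium g numax r w \<pi>' \<nu>' \<longrightarrow>
        leader_cost r w \<pi> \<nu> \<le> leader_cost r w \<pi>' \<nu>')"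

definition perfect_stackelberg_equilibrium ::
  "('n::finite \<Rightarrow> real) \<Rightarrow> ('n \<Rightarrow> real) \<Rightarrow> ('t::finite \<Rightarrow> real) \<Rightarrow> ('t \<Rightarrow> real) \<Rightarrow>
   leader_strategy \<Rightarrow> ('n \<Rightarrow> real ^ 't) \<Rightarrow> bool"
where
  "perfect_stackelberg_equilibrium g numax r w \<pi> \<nu> \<longleftrightarrow>
     stackelberg_equilibrium g numax r w \<pi> \<nu> \<and> leader_cost r w \<pi> \<nu> = 0"

definition price_star :: "nat \<Rightarrow> leader_strategy" where
  "price_star n = (\<lambda>a \<rho> \<omega>. 1 + 1 / real n + a / (\<omega> - \<rho>))"

definition chi_star ::
  "('n::finite \<Rightarrow> real) \<Rightarrow> ('t::finite \<Rightarrow> real) \<Rightarrow> ('t \<Rightarrow> real) \<Rightarrow> 'n \<Rightarrow> real ^ 't"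
where
  "chi_star g r w i = (g i / total_demand g) *\<^sub>R (\<chi> t. w t - r t)"

end

theory Submission
  imports Defs
begin

text \<open>
  Write \<open>d t = w t - r t\<close> for the uncontrollable energy left to the followers, and \<open>G\<close> for their
  total demand. The profile \<open>chi_star\<close> splits \<open>d\<close> among the followers in proportion to their
  demands, so the aggregate is exactly \<open>d\<close> and the price is the constant \<open>2 + 1/n\<close> in every slot.
  If follower \<open>i\<close> deviates by \<open>\<delta>\<close> with \<open>\<Sum>t. \<delta> t = 0\<close>, the price at \<open>t\<close> changes by \<open>\<delta> t / d t\<close>,
  and its cost becomes
  \<open>(\<Sum>t. (2 + 1/n + \<delta> t / d t) * (g i / G * d t + \<delta> t)) = (2 + 1/n) * g i + (\<Sum>t. (\<delta> t)\<^sup>2 / d t)\<close>.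
  The cross term \<open>(\<delta> t / d t) * (g i / G) * d t\<close> is a constant multiple of \<open>\<delta> t\<close> and sums to zero:
  dividing the aggregate by \<open>d\<close> in the price is what makes the proportional split stationary. The
  quadratic remainder is nonnegative, so no deviation pays
  (\<open>follower_cost_deviation_from_chi_star\<close>). The leader's cost is the variance of the controllable supply, hence nonnegative,
  and it vanishes here because that supply is zero in every slot. So the profile is optimal among all
  equilibria of all pricing rules.
\<close>

lemma aggregate_chi_star:
  assumes "total_demand g \<noteq> 0"
  shows "aggregate (chi_star g r w) t = w t - r t"
proof -
  have "aggregate (chi_star g r w) t = (\<Sum>i\<in>UNIV. g i) / total_demand g * (w t - r t)"
    by (simp add: aggregate_def chi_star_def sum_divide_distrib sum_distrib_right)
  then show ?thesis
    using assms by (simp add: total_demand_def)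
qed

lemma aggregate_fun_upd:
  "aggregate (\<nu>(i := x)) t = aggregate \<nu> t + (x $ t - \<nu> i $ t)"
  by (simp add: aggregate_def sum.remove[of UNIV i])

lemma total_demand_pos:
  assumes "\<And>i. g i > 0"
  shows "total_demand g > 0"
  unfolding total_demand_def using assms by (intro sum_pos) auto

lemma sum_chi_star:
  assumes "total_demand g \<noteq> 0" and "(\<Sum>t\<in>UNIV. w t - r t) = total_demand g"
  shows "(\<Sum>t\<in>UNIV. chi_star g r w i $ t) = g i"
proof -
  have "(\<Sum>t\<in>UNIV. chi_star g r w i $ t) = g i / total_demand g * (\<Sum>t\<in>UNIV. w t - r t)"
    by (simp add: chi_star_def sum_distrib_left)
  then show ?thesis
    using assms by simp
qed

text \<open>
  The bound on \<open>w t - r t\<close> is the one under which every follower's share of it, at every time,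
  respects that follower's own maximal demand.
\<close>

lemma feasible_chi_star:
  assumes g: "\<And>i. g i > 0"
    and nonneg: "\<And>t. 0 \<le> w t - r t"
    and cap: "\<And>t. w t - r t \<le> Min (range (\<lambda>i. numax i / g i)) * total_demand g"
    and balance: "(\<Sum>t\<in>UNIV. w t - r t) = total_demand g"
  shows "feasible (g i) (numax i) (chi_star g r w i)"
proof -
  note G = total_demand_pos[of g, OF g]
  have "0 \<le> chi_star g r w i $ t" for t
    using g[of i] G nonneg[of t] by (simp add: chi_star_def)
  moreover have "chi_star g r w i $ t \<le> numax i" for t
  proof -
    have "Min (range (\<lambda>i. numax i / g i)) \<le> numax i / g i"
      by (rule Min_le) auto
    then have "w t - r t \<le> numax i / g i * total_demand g"
      using cap[of t] G by (meson mult_right_mono less_imp_le order_trans)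
    then show ?thesis
      using g[of i] G by (simp add: chi_star_def field_simps)
  qed
  ultimately show ?thesis
    using sum_chi_star[of g w r i] G balance by (simp add: feasible_def)
qed

text \<open>
  The deviator pays the constant price on its whole demand, plus a penalty that is quadratic in the
  deviation. The terms linear in the deviation cancel because every strategy serves the same total
  demand \<open>g i\<close>. Taking \<open>x = chi_star g r w i\<close> gives the cost of \<open>chi_star\<close> itself.
\<close>

lemma follower_cost_deviation_from_chi_star:
  fixes g :: "'n::finite \<Rightarrow> real" and r w :: "'t::finite \<Rightarrow> real"
  assumes G: "total_demand g \<noteq> 0"
    and d: "\<And>t. w t - r t \<noteq> 0"
    and balance: "(\<Sum>t\<in>UNIV. w t - r t) = total_demand g"
    and x: "(\<Sum>t\<in>UNIV. x $ t) = g i"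
  shows "follower_cost r w i (price_star n) ((chi_star g r w)(i := x)) =
    (2 + 1 / real n) * g i + (\<Sum>t\<in>UNIV. (x $ t - chi_star g r w i $ t)\<^sup>2 / (w t - r t))"
proof -
  define \<delta> where "\<delta> t = x $ t - chi_star g r w i $ t" for t
  have sum_\<delta>: "(\<Sum>t\<in>UNIV. \<delta> t) = 0"
    using x sum_chi_star[OF G balance, of i] by (simp add: \<delta>_def sum_subtractf)
  have summand: "price_star n (aggregate ((chi_star g r w)(i := x)) t) (r t) (w t) * x $ t =
      (2 + 1 / real n) * x $ t + g i / total_demand g * \<delta> t + (\<delta> t)\<^sup>2 / (w t - r t)" for t
  proof -
    have price: "price_star n (aggregate ((chi_star g r w)(i := x)) t) (r t) (w t) =
        2 + 1 / real n + \<delta> t / (w t - r t)"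
      using d[of t] by (simp add: price_star_def aggregate_fun_upd aggregate_chi_star[OF G]
          \<delta>_def add_divide_distrib)
    have split: "x $ t = g i / total_demand g * (w t - r t) + \<delta> t"
      by (simp add: \<delta>_def chi_star_def)
    have "\<delta> t / (w t - r t) * x $ t = g i / total_demand g * \<delta> t + (\<delta> t)\<^sup>2 / (w t - r t)"
      unfolding split using d[of t] G
      by (simp add: distrib_left power2_eq_square)
    then show ?thesis
      unfolding price by (simp only: distrib_right add.assoc)
  qed
  have "follower_cost r w i (price_star n) ((chi_star g r w)(i := x)) =
      (2 + 1 / real n) * (\<Sum>t\<in>UNIV. x $ t) + g i / total_demand g * (\<Sum>t\<in>UNIV. \<delta> t)
        + (\<Sum>t\<in>UNIV. (\<delta> t)\<^sup>2 / (w t - r t))"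
    by (simp only: follower_cost_def fun_upd_same summand sum.distrib sum_distrib_left)
  then show ?thesis
    by (simp add: x sum_\<delta>) (simp add: \<delta>_def)
qed

lemma nash_equilibrium_chi_star:
  fixes g numax :: "'n::finite \<Rightarrow> real" and r w :: "'t::finite \<Rightarrow> real"
  assumes g: "\<And>i. g i > 0"
    and pos: "\<And>t. 0 < w t - r t"
    and cap: "\<And>t. w t - r t \<le> Min (range (\<lambda>i. numax i / g i)) * total_demand g"
    and balance: "(\<Sum>t\<in>UNIV. w t - r t) = total_demand g"
  shows "nash_equilibrium g numax r w (price_star n) (chi_star g r w)"
proof -
  have G: "total_demand g \<noteq> 0"
    using total_demand_pos[of g, OF g] by simp
  have d: "w t - r t \<noteq> 0" for t
    using pos[of t] by simp
  note cost = follower_cost_deviation_from_chi_star[of g w r, OF G d balance]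
  have "follower_cost r w i (price_star n) (chi_star g r w)
      \<le> follower_cost r w i (price_star n) ((chi_star g r w)(i := x))"
    if x: "feasible (g i) (numax i) x" for i x
  proof -
    have "follower_cost r w i (price_star n) (chi_star g r w) = (2 + 1 / real n) * g i"
      using cost[OF sum_chi_star[OF G balance], of i n] by simp
    moreover have "0 \<le> (\<Sum>t\<in>UNIV. (x $ t - chi_star g r w i $ t)\<^sup>2 / (w t - r t))"
      by (intro sum_nonneg divide_nonneg_pos pos zero_le_power2)
    ultimately show ?thesis
      using cost[of x i n] x by (simp add: feasible_def)
  qed
  moreover have "feasible (g i) (numax i) (chi_star g r w i)" for i
    using feasible_chi_star[where g = g and r = r and w = w and numax = numax and i = i, OF g less_imp_le[OF pos] cap balance] .
  ultimately show ?thesis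
    unfolding nash_equilibrium_def by blast
qed

lemma leader_cost_nonneg: "0 \<le> leader_cost r w \<pi> \<nu>"
  by (simp add: leader_cost_def sum_nonneg)

lemma leader_cost_eq_0_if_no_supply:
  assumes "\<And>t. controllable_supply r w \<nu> t = 0"
  shows "leader_cost r w \<pi> \<nu> = 0"
  by (simp add: leader_cost_def mean_supply_def assms)

theorem corollary3p1:
  fixes g numax :: "'n::finite \<Rightarrow> real"
    and r w :: "'t::finite \<Rightarrow> real"
  assumes "\<And>i. g i > 0"
    and "\<And>i. numax i \<ge> g i / real CARD('t)"
    and "\<And>t. 0 < w t - r t"
    and "\<And>t. w t - r t \<le> Min (range (\<lambda>i. numax i / g i)) * total_demand g"
    and "(\<Sum>t\<in>UNIV. w t) = total_demand g + (\<Sum>t\<in>UNIV. r t)"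
  shows "perfect_stackelberg_equilibrium g numax r w (price_star CARD('n)) (chi_star g r w)
       \<and> (\<forall>t. controllable_supply r w (chi_star g r w) t = 0)"
proof -
  have balance: "(\<Sum>t\<in>UNIV. w t - r t) = total_demand g"
    using assms(5) by (simp add: sum_subtractf)
  have "total_demand g \<noteq> 0"
    using total_demand_pos[of g, OF assms(1)] by simp
  then have no_supply: "controllable_supply r w (chi_star g r w) t = 0" for t
    by (simp add: controllable_supply_def aggregate_chi_star)
  have "nash_equilibrium g numax r w (price_star CARD('n)) (chi_star g r w)"
    using nash_equilibrium_chi_star[where g = g and w = w and r = r and numax = numax, OF assms(1,3,4) balance] .
  then show ?thesis
    by (simp add: perfect_stackelberg_equilibrium_def stackelberg_equilibrium_def
        leader_cost_eq_0_if_no_supply no_supply leader_cost_nonneg)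
qed

end
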